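(* Let $A$ be an algebra over a field $F$ with $\mathrm{char}(F)\neq 2$. If $A$ is generated (as an algebra) by two axes $a$ and $b$ of Jordan type (whose types may be distinct), then $$A=Fa+Fb+Fab.$$
   Context: Algebras are not necessarily associative, commutative or unital. For $a\in A$ put $L_a(x)=ax$, $R_a(x)=xa$; for $X\in\{L,R\}$ let $A_\lambda(X_a)=\{v: X_a(v)=\lambda v\}$, write $A_\lambda=A_\lambda(L_a)$, and $A_{\lambda,\delta}=A_\lambda(L_a)\cap A_\delta(R_a)$. Let $a$ be an idempotent ($a^2=a$) and $\lambda,\delta\in F\setminus\{0,1\}$. $a$ is a left axis of type $\lambda$ if: (a) $A_1(L_a)=Fa$; (b) $(L_a-\lambda)(L_a-1)L_a=0$; (c) the decomposition $A=(A_0\oplus A_1)\oplus A_\lambda$ (eigenspaces of $L_a$) is a $\mathbb Z_2$-grading of $A$ with $+$-part $A_0\oplus A_1$ and $-$-part $A_\lambda$. ($A_0$ is not required to be a subalgebra.) A right axis of type $\delta$ is defined similarly using $R_a$. $a$ is an axis of type $(\lambda,\delta)$ if it is a left axis of type $\lambda$, a right axis of type $\delta$, and $L_aR_a=R_aL_a$. An axis $a$ of type $(\lambda,\delta)$ is of Jordan type $(\lambda,\delta)$ if $A_{\lambda,0}=A_{0,\delta}=0$. *)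

theory Defs
  imports "HOL-Computational_Algebra.Computational_Algebra" "HOL-Library.Set_Algebras"
begin

(* The algebra is the whole type 'a: only bilinearity of the product is assumed. *)
locale nonassoc_algebra = vector_space scale
  for scale :: "'f::field \<Rightarrow> 'a::ab_group_add \<Rightarrow> 'a" (infixr \<open>*s\<close> 75) +
  fixes mult :: "'a \<Rightarrow> 'a \<Rightarrow> 'a" (infixl \<open>\<cdot>\<close> 70)
  assumes mult_add_left: "(x + y) \<cdot> z = x \<cdot> z + y \<cdot> z"
    and mult_add_right: "x \<cdot> (y + z) = x \<cdot> y + x \<cdot> z"
    and mult_scale_left: "(c *s x) \<cdot> y = c *s (x \<cdot> y)"
    and mult_scale_right: "x \<cdot> (c *s y) = c *s (x \<cdot> y)"
begin

definition L :: "'a \<Rightarrow> 'a \<Rightarrow> 'a" where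
  "L a = (\<lambda>x. a \<cdot> x)"

definition R :: "'a \<Rightarrow> 'a \<Rightarrow> 'a" where
  "R a = (\<lambda>x. x \<cdot> a)"

definition eigenspace :: "('a \<Rightarrow> 'a) \<Rightarrow> 'f \<Rightarrow> 'a set" where
  "eigenspace X \<mu> = {v. X v = \<mu> *s v}"

definition shift :: "('a \<Rightarrow> 'a) \<Rightarrow> 'f \<Rightarrow> 'a \<Rightarrow> 'a" where
  "shift X \<mu> = (\<lambda>v. X v - \<mu> *s v)"

definition subalgebra :: "'a set \<Rightarrow> bool" where
  "subalgebra S \<longleftrightarrow> subspace S \<and> (\<forall>x\<in>S. \<forall>y\<in>S. x \<cdot> y \<in> S)"

definition generated_by :: "'a set \<Rightarrow> bool" where
  "generated_by S \<longleftrightarrow> subalgebra hull S = UNIV"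

definition Z2_grading :: "'a set \<Rightarrow> 'a set \<Rightarrow> bool" where
  "Z2_grading P M \<longleftrightarrow>
     subspace P \<and> subspace M \<and> P + M = UNIV \<and> P \<inter> M = {0} \<and>
     (\<forall>x\<in>P. \<forall>y\<in>P. x \<cdot> y \<in> P) \<and>
     (\<forall>x\<in>P. \<forall>y\<in>M. x \<cdot> y \<in> M) \<and>
     (\<forall>x\<in>M. \<forall>y\<in>P. x \<cdot> y \<in> M) \<and>
     (\<forall>x\<in>M. \<forall>y\<in>M. x \<cdot> y \<in> P)"

(* The conditions common to left axes (X = L a) and right axes (X = R a). *)
definition axis_wrt :: "('a \<Rightarrow> 'a) \<Rightarrow> 'a \<Rightarrow> 'f \<Rightarrow> bool" where
  "axis_wrt X a \<mu> \<longleftrightarrow>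
     a \<cdot> a = a \<and> \<mu> \<notin> {0, 1} \<and>
     eigenspace X 1 = span {a} \<and>
     shift X \<mu> \<circ> shift X 1 \<circ> X = (\<lambda>v. 0) \<and>
     eigenspace X 0 \<inter> eigenspace X 1 = {0} \<and>
     Z2_grading (eigenspace X 0 + eigenspace X 1) (eigenspace X \<mu>)"

definition left_axis :: "'a \<Rightarrow> 'f \<Rightarrow> bool" where
  "left_axis a \<mu> \<longleftrightarrow> axis_wrt (L a) a \<mu>"

definition right_axis :: "'a \<Rightarrow> 'f \<Rightarrow> bool" where
  "right_axis a \<delta> \<longleftrightarrow> axis_wrt (R a) a \<delta>"

definition axis :: "'a \<Rightarrow> 'f \<Rightarrow> 'f \<Rightarrow> bool" where
  "axis a \<mu> \<delta> \<longleftrightarrow> left_axis a \<mu> \<and> right_axis a \<delta> \<and> L a \<circ> R a = R a \<circ> L a"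

definition joint_eigenspace :: "'a \<Rightarrow> 'f \<Rightarrow> 'f \<Rightarrow> 'a set" where
  "joint_eigenspace a \<mu> \<delta> = eigenspace (L a) \<mu> \<inter> eigenspace (R a) \<delta>"

definition jordan_axis :: "'a \<Rightarrow> 'f \<Rightarrow> 'f \<Rightarrow> bool" where
  "jordan_axis a \<mu> \<delta> \<longleftrightarrow>
     axis a \<mu> \<delta> \<and> joint_eigenspace a \<mu> 0 = {0} \<and> joint_eigenspace a 0 \<delta> = {0}"

end

end

(* With respect to a Jordan axis a the algebra splits as Fa + A_{0,0} + A_{\<mu>,\<delta>}. Writing
   b = \<alpha>a + b0 + b1 accordingly, ab and ba are combinations of a and b1, so that
   V = Fa + Fb + Fab = Fa + Fb + Fba is spanned by a, b0, b1 and is stable under left and right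
   multiplication by a; by symmetry it is also stable under multiplication by b. Hence
   b0 b0 + b1 b0 and b0 b1 + b1 b1 lie in V. Each sum consists of a +-part and a --part for the
   grading of a, and V is a graded subspace, so all four products lie in V. *)
theory Submission
  imports Defs
begin

context nonassoc_algebra
begin

lemma mult_zero_left [simp]: "0 \<cdot> x = 0"
  using mult_add_left[of 0 0 x] by simp

lemma mult_zero_right [simp]: "x \<cdot> 0 = 0"
  using mult_add_right[of x 0 0] by simp

lemma mult_minus_left: "(- x) \<cdot> y = - (x \<cdot> y)"
  using mult_scale_left[of "- 1" x y] by simp

lemma mult_minus_right: "x \<cdot> (- y) = - (x \<cdot> y)"
  using mult_scale_right[of x "- 1" y] by simp

lemma mult_diff_left: "(x - y) \<cdot> z = x \<cdot> z - y \<cdot> z"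
  using mult_add_left[of x "- y" z] by (simp add: mult_minus_left)

lemma mult_diff_right: "x \<cdot> (y - z) = x \<cdot> y - x \<cdot> z"
  using mult_add_right[of x y "- z"] by (simp add: mult_minus_right)

lemmas mult_simps = mult_add_left mult_add_right mult_diff_left mult_diff_right
  mult_scale_left mult_scale_right

lemma span_mult_closed:
  assumes "subspace V" "\<And>s t. s \<in> S \<Longrightarrow> t \<in> T \<Longrightarrow> s \<cdot> t \<in> V"
    and x: "x \<in> span S" and y: "y \<in> span T"
  shows "x \<cdot> y \<in> V"
proof -
  have "s \<cdot> y \<in> V" if "s \<in> S" for s
    using y
    by (induction rule: span_induct_alt)
      (auto simp: mult_simps intro!: assms that subspace_add subspace_scale subspace_0)
  with x show ?thesis
    by (induction rule: span_induct_alt)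
      (auto simp: mult_simps intro!: assms(1) subspace_add subspace_scale subspace_0)
qed

text \<open>A vector fixed by \<open>X\<close> is also fixed by \<open>Y\<close>, and under
  \<open>Y\<close> it cannot have a second eigenvalue \<open>\<kappa>\<close> unless it is 0.
  Applied with \<open>X = R a\<close> and \<open>Y = L a\<close>, whose eigenspaces for 1 are both
  Fa.\<close>

lemma eigenvector_1_in_other_eigenspace_eq_0:
  assumes "eigenspace X 1 = eigenspace Y 1" "\<kappa> \<noteq> 1"
    and "X u = u" "u \<in> eigenspace Y \<kappa>"
  shows "u = 0"
proof -
  have "(\<kappa> - 1) *s u = 0"
  proof -
    have "u \<in> eigenspace Y 1"
      unfolding assms(1)[symmetric] using assms(3) by (simp add: eigenspace_def)
    with assms(4) show ?thesis
      by (simp add: eigenspace_def scale_left_diff_distrib)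
  qed
  then show ?thesis using \<open>\<kappa> \<noteq> 1\<close> by simp
qed

text \<open>Since \<open>L a\<close> and \<open>R a\<close> commute, \<open>R a\<close> preserves
  each eigenspace of \<open>L a\<close>, and there it is annihilated by (t - \<delta>)(t - 1)t. The
  root 1 is excluded because its eigenvectors lie in Fa; the Jordan condition excludes \<delta> on
  the 0-eigenspace and 0 on the \<mu>-eigenspace. A single root remains in each case.\<close>

lemma jordan_axis_left_eigenvectors:
  assumes j: "jordan_axis a \<mu> \<delta>"
  shows "a \<cdot> q = 0 \<Longrightarrow> q \<cdot> a = 0"
    and "a \<cdot> m = \<mu> *s m \<Longrightarrow> m \<cdot> a = \<delta> *s m"
proof -
  have \<mu>: "\<mu> \<noteq> 1"
    and fixed: "eigenspace (R a) 1 = eigenspace (L a) 1"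
    and poly: "shift (R a) \<delta> (shift (R a) 1 (R a v)) = 0"
    and LR: "a \<cdot> (v \<cdot> a) = (a \<cdot> v) \<cdot> a" for v
    using j unfolding jordan_axis_def axis_def left_axis_def right_axis_def axis_wrt_def
    by (auto simp: fun_eq_iff L_def R_def)
  \<comment> \<open>The cubic identity solved for its leading term, so that it rewrites third powers
    of \<open>R a\<close>.\<close>
  have poly': "((v \<cdot> a) \<cdot> a) \<cdot> a = (\<delta> + 1) *s ((v \<cdot> a) \<cdot> a) - \<delta> *s (v \<cdot> a)" for v
    using poly[of v]
    by (simp add: shift_def R_def mult_simps algebra_simps)
  have joint: "v = 0" if "a \<cdot> v = \<mu> *s v" "v \<cdot> a = 0" for v
  proof -
    have "v \<in> joint_eigenspace a \<mu> 0"
      using that by (simp add: joint_eigenspace_def eigenspace_def L_def R_def)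
    then show ?thesis using j by (simp add: jordan_axis_def)
  qed
  have joint': "v = 0" if "a \<cdot> v = 0" "v \<cdot> a = \<delta> *s v" for v
  proof -
    have "v \<in> joint_eigenspace a 0 \<delta>"
      using that by (simp add: joint_eigenspace_def eigenspace_def L_def R_def)
    then show ?thesis using j by (simp add: jordan_axis_def)
  qed
  show "q \<cdot> a = 0" if q: "a \<cdot> q = 0"
  proof -
    \<comment> \<open>By the cubic identity, (\<open>R a\<close> - 1) \<open>R a\<close> q is a
      \<delta>-eigenvector of \<open>R a\<close>; by commutativity \<open>L a\<close> kills it, so
      the Jordan condition makes it 0.\<close>
    have "(q \<cdot> a) \<cdot> a - q \<cdot> a = 0"
      by (rule joint') (simp_all add: mult_simps LR q poly' algebra_simps)
    then have "R a (q \<cdot> a) = q \<cdot> a" by (simp add: R_def)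
    moreover have "q \<cdot> a \<in> eigenspace (L a) 0"
      by (simp add: eigenspace_def L_def LR q)
    ultimately show ?thesis
      using eigenvector_1_in_other_eigenspace_eq_0[OF fixed, of 0] by simp
  qed
  show "m \<cdot> a = \<delta> *s m" if m: "a \<cdot> m = \<mu> *s m"
  proof -
    \<comment> \<open>Applying \<open>R a\<close> - 1 to \<open>?u\<close> = (\<open>R a\<close> -
      \<delta>) m gives a vector that \<open>R a\<close> kills by the cubic identity and that still
      has eigenvalue \<mu> under \<open>L a\<close>; the Jordan condition makes it 0.\<close>
    let ?u = "m \<cdot> a - \<delta> *s m"
    have "?u \<cdot> a - ?u = 0"
      by (rule joint) (simp_all add: mult_simps LR m poly' algebra_simps)
    then have "R a ?u = ?u" by (simp add: R_def)
    moreover have "?u \<in> eigenspace (L a) \<mu>"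
      by (simp add: eigenspace_def L_def mult_simps LR m algebra_simps)
    ultimately have "?u = 0"
      using eigenvector_1_in_other_eigenspace_eq_0[OF fixed \<mu>] by blast
    then show ?thesis by simp
  qed
qed

lemma jordan_axis_grading:
  assumes "jordan_axis a \<mu> \<delta>"
  shows "Z2_grading (eigenspace (L a) 0 + eigenspace (L a) 1) (eigenspace (L a) \<mu>)"
  using assms unfolding jordan_axis_def axis_def left_axis_def axis_wrt_def by blast

text \<open>Only the eigenspaces of \<open>L a\<close> are used to split \<open>x\<close>; the
  behaviour of the components under \<open>R a\<close> then follows from
  \<open>jordan_axis_left_eigenvectors\<close>.\<close>

lemma jordan_axis_decomposition:
  assumes j: "jordan_axis a \<mu> \<delta>"
  obtains \<alpha> x0 x1 where "x = \<alpha> *s a + x0 + x1"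
    "a \<cdot> x0 = 0" "x0 \<cdot> a = 0" "a \<cdot> x1 = \<mu> *s x1" "x1 \<cdot> a = \<delta> *s x1"
proof -
  have "x \<in> (eigenspace (L a) 0 + eigenspace (L a) 1) + eigenspace (L a) \<mu>"
    using jordan_axis_grading[OF j] unfolding Z2_grading_def by blast
  then obtain x0 y x1 where x: "x = x0 + y + x1" "x0 \<in> eigenspace (L a) 0"
    "y \<in> eigenspace (L a) 1" "x1 \<in> eigenspace (L a) \<mu>"
    by (auto elim!: set_plus_elim)
  moreover obtain \<alpha> where "y = \<alpha> *s a"
    using \<open>y \<in> _\<close> j unfolding jordan_axis_def axis_def left_axis_def axis_wrt_def
    by (auto simp: span_singleton)
  ultimately show thesis
    using jordan_axis_left_eigenvectors[OF j]
    by (intro that[of \<alpha> x0 x1]) (auto simp: eigenspace_def L_def algebra_simps)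
qed

lemma jordan_axis_idem: "jordan_axis a \<mu> \<delta> \<Longrightarrow> a \<cdot> a = a"
  unfolding jordan_axis_def axis_def left_axis_def axis_wrt_def by blast

lemma jordan_axis_span:
  assumes j: "jordan_axis a \<mu> \<delta>" and x: "x = \<alpha> *s a + x0 + x1"
    and eig: "a \<cdot> x0 = 0" "x0 \<cdot> a = 0" "a \<cdot> x1 = \<mu> *s x1" "x1 \<cdot> a = \<delta> *s x1"
  shows "span {a, x, a \<cdot> x} = span {a, x0, x1}"
    and "span {a, x, x \<cdot> a} = span {a, x0, x1}"
proof -
  have aa: "a \<cdot> a = a" using j by (rule jordan_axis_idem)
  have nz: "\<mu> \<noteq> 0" "\<delta> \<noteq> 0"
    using j unfolding jordan_axis_def axis_def left_axis_def right_axis_def axis_wrt_def by auto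
  \<comment> \<open>Treats both products at once: \<nu> is \<mu> for \<open>a \<cdot> x\<close> and
    \<delta> for \<open>x \<cdot> a\<close>. As \<nu> is invertible, x1 can be recovered, and then
    x0.\<close>
  have *: "span {a, x, \<alpha> *s a + \<nu> *s x1} = span {a, x0, x1}" if "\<nu> \<noteq> 0" for \<nu>
  proof (rule span_eq[THEN iffD2, OF conjI])
    show "{a, x, \<alpha> *s a + \<nu> *s x1} \<subseteq> span {a, x0, x1}"
      by (auto simp: x intro!: span_add span_scale intro: span_base)
    let ?V = "span {a, x, \<alpha> *s a + \<nu> *s x1}"
    have "inverse \<nu> *s ((\<alpha> *s a + \<nu> *s x1) - \<alpha> *s a) \<in> ?V"
      by (intro span_scale span_diff) (auto intro: span_base)
    then have x1: "x1 \<in> ?V" using \<open>\<nu> \<noteq> 0\<close> by simp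
    have "x - \<alpha> *s a - x1 \<in> ?V"
      by (intro span_diff span_scale x1) (auto intro: span_base)
    then have "x0 \<in> ?V" by (simp add: x)
    with x1 show "{a, x0, x1} \<subseteq> ?V" by (auto intro: span_base)
  qed
  have "a \<cdot> x = \<alpha> *s a + \<mu> *s x1" "x \<cdot> a = \<alpha> *s a + \<delta> *s x1"
    by (simp_all add: x mult_simps eig aa)
  with * nz show "span {a, x, a \<cdot> x} = span {a, x0, x1}"
    and "span {a, x, x \<cdot> a} = span {a, x0, x1}" by simp_all
qed

text \<open>Both spans equal that of the components of \<open>x\<close>. This is what makes the
  situation symmetric in the two axes.\<close>

lemma jordan_axis_span_commute:
  assumes "jordan_axis a \<mu> \<delta>"
  shows "span {a, x, x \<cdot> a} = span {a, x, a \<cdot> x}"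
  using jordan_axis_decomposition[OF assms, of x] jordan_axis_span[OF assms] by metis

text \<open>The span has a spanning set \<open>a\<close>, x0, x1 of common eigenvectors of
  \<open>L a\<close> and \<open>R a\<close>.\<close>

lemma jordan_axis_span_invariant:
  assumes j: "jordan_axis a \<mu> \<delta>" and v: "v \<in> span {a, x, a \<cdot> x}"
  shows "a \<cdot> v \<in> span {a, x, a \<cdot> x}" "v \<cdot> a \<in> span {a, x, a \<cdot> x}"
proof -
  obtain \<alpha> x0 x1 where x: "x = \<alpha> *s a + x0 + x1"
    and eig: "a \<cdot> x0 = 0" "x0 \<cdot> a = 0" "a \<cdot> x1 = \<mu> *s x1" "x1 \<cdot> a = \<delta> *s x1"
    using jordan_axis_decomposition[OF j] .
  note V = jordan_axis_span(1)[OF j x eig]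
  have v': "v \<in> span {a, x0, x1}" using v V by simp
  have base: "a \<in> span {a, x0, x1}" "x0 \<in> span {a, x0, x1}" "x1 \<in> span {a, x0, x1}"
    by (simp_all add: span_base)
  have a: "a \<in> span {a}" by (simp add: span_base)
  have "a \<cdot> v \<in> span {a, x0, x1}"
    by (rule span_mult_closed[OF _ _ a v'])
      (auto simp: jordan_axis_idem[OF j] eig intro!: base span_scale span_zero)
  moreover have "v \<cdot> a \<in> span {a, x0, x1}"
    by (rule span_mult_closed[OF _ _ v' a])
      (auto simp: jordan_axis_idem[OF j] eig intro!: base span_scale span_zero)
  ultimately show "a \<cdot> v \<in> span {a, x, a \<cdot> x}" "v \<cdot> a \<in> span {a, x, a \<cdot> x}"
    by (simp_all add: V)
qed

text \<open>A subspace spanned by homogeneous elements contains the homogeneous components of its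
  members: comparing p + m with a splitting s + t along the generators puts p - s = t - m into both
  P and M.\<close>

lemma span_graded:
  assumes P: "subspace P" and M: "subspace M" and PM: "P \<inter> M = {0}"
    and S: "S \<subseteq> P" and T: "T \<subseteq> M" and p: "p \<in> P" and m: "m \<in> M"
    and pm: "p + m \<in> span (S \<union> T)"
  shows "p \<in> span (S \<union> T)" "m \<in> span (S \<union> T)"
proof -
  obtain s t where st: "p + m = s + t" "s \<in> span S" "t \<in> span T"
    using pm by (auto simp: span_Un)
  have "s \<in> P" "t \<in> M"
    using st span_minimal[OF S P] span_minimal[OF T M] by auto
  moreover have "p - s = t - m" using st(1) by (simp add: algebra_simps)
  ultimately have "p - s \<in> P \<inter> M"
    using subspace_diff[OF P p, of s] subspace_diff[OF M _ m, of t] by auto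
  then have "p = s" "m = t" using PM st(1) by auto
  then show "p \<in> span (S \<union> T)" "m \<in> span (S \<union> T)"
    using st span_mono[of S "S \<union> T"] span_mono[of T "S \<union> T"] by auto
qed

lemma subalgebra_span_two_jordan_axes:
  assumes ja: "jordan_axis a \<mu> \<delta>" and jb: "jordan_axis b \<mu>' \<delta>'"
  shows "subalgebra (span {a, b, a \<cdot> b})"
proof -
  obtain \<alpha> b0 b1 where b: "b = \<alpha> *s a + b0 + b1"
    and eig: "a \<cdot> b0 = 0" "b0 \<cdot> a = 0" "a \<cdot> b1 = \<mu> *s b1" "b1 \<cdot> a = \<delta> *s b1"
    using jordan_axis_decomposition[OF ja] .
  define V where "V = span {a, b0, b1}"
  have V: "span {a, b, a \<cdot> b} = V"
    unfolding V_def using jordan_axis_span(1)[OF ja b eig] .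
  \<comment> \<open>Puts V into the shape to which the invariance lemma applies with
    \<open>b\<close> as the axis.\<close>
  have V': "span {b, a, b \<cdot> a} = V"
    using jordan_axis_span_commute[OF ja, of b] V by (simp add: insert_commute)
  have subV: "subspace V" by (simp add: V_def)
  have inV: "a \<in> V" "b0 \<in> V" "b1 \<in> V" by (auto simp: V_def intro: span_base)
  have aV: "a \<cdot> v \<in> V" "v \<cdot> a \<in> V" if "v \<in> V" for v
    using jordan_axis_span_invariant[OF ja, of v b] that by (simp_all add: V)
  have bV: "b \<cdot> v \<in> V" if "v \<in> V" for v
    using jordan_axis_span_invariant(1)[OF jb, of v a] that by (simp add: V')
  have b01: "b0 \<cdot> v + b1 \<cdot> v \<in> V" if "v \<in> V" for v
  proof -
    have "b \<cdot> v - \<alpha> *s (a \<cdot> v) \<in> V"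
      using that subV by (intro subspace_diff subspace_scale bV aV)
    also have "b \<cdot> v - \<alpha> *s (a \<cdot> v) = b0 \<cdot> v + b1 \<cdot> v" by (simp add: b mult_simps)
    finally show ?thesis .
  qed
  define P where "P = eigenspace (L a) 0 + eigenspace (L a) 1"
  define M where "M = eigenspace (L a) \<mu>"
  have grading: "Z2_grading P M"
    unfolding P_def M_def using ja by (rule jordan_axis_grading)
  \<comment> \<open>The zero summands exhibit both vectors as members of the set sum P.\<close>
  have "b0 + 0 \<in> P" "0 + a \<in> P"
    unfolding P_def using eig jordan_axis_idem[OF ja]
    by (intro set_plus_intro; simp add: eigenspace_def L_def)+
  then have P: "b0 \<in> P" "a \<in> P" by simp_all
  have M: "b1 \<in> M" using eig by (simp add: M_def eigenspace_def L_def)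
  have PM: "subspace P" "subspace M" "P \<inter> M = {0}"
    using grading unfolding Z2_grading_def by blast+
  have split: "p \<in> V" "m \<in> V" if "p + m \<in> V" "p \<in> P" "m \<in> M" for p m
    using span_graded[OF PM, of "{a, b0}" "{b1}" p m] that P M
    by (auto simp: V_def insert_commute)
  have "b0 \<cdot> b0 \<in> P" "b1 \<cdot> b0 \<in> M" "b0 \<cdot> b1 \<in> M" "b1 \<cdot> b1 \<in> P"
    using grading P M unfolding Z2_grading_def by blast+
  \<comment> \<open>For v = b0 the P-part of the sum is b0 b0 and the M-part b1 b0; for v = b1 the
    parities are reversed, so the summands are swapped before splitting.\<close>
  then have prods: "b0 \<cdot> b0 \<in> V" "b1 \<cdot> b0 \<in> V" "b0 \<cdot> b1 \<in> V" "b1 \<cdot> b1 \<in> V"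
    using split[OF b01[OF inV(2)]] split[of "b1 \<cdot> b1" "b0 \<cdot> b1"] b01[OF inV(3)]
    by (simp_all add: add.commute)
  have "x \<cdot> y \<in> V" if "x \<in> V" "y \<in> V" for x y
    by (rule span_mult_closed[of V "{a, b0, b1}" "{a, b0, b1}"])
      (use that subV aV inV prods in \<open>auto simp: V_def[symmetric]\<close>)
  then show ?thesis unfolding V subalgebra_def using subV by blast
qed

lemma generated_by_two_jordan_axes:
  assumes ja: "jordan_axis a \<mu> \<delta>" and jb: "jordan_axis b \<mu>' \<delta>'"
    and gen: "generated_by {a, b}"
  shows "UNIV = span {a} + span {b} + span {a \<cdot> b}"
proof -
  have "subalgebra hull {a, b} \<subseteq> span {a, b, a \<cdot> b}"
    by (intro hull_minimal subalgebra_span_two_jordan_axes[OF ja jb]) (auto intro: span_base)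
  \<comment> \<open>The generators are written as a union of singletons so that
    \<open>span_Un\<close> can break the span into a sum.\<close>
  then have "UNIV = span ({a} \<union> {b} \<union> {a \<cdot> b})"
    using gen by (auto simp: generated_by_def insert_commute)
  also have "\<dots> = span {a} + span {b} + span {a \<cdot> b}"
    by (subst span_Un, subst span_Un) (auto simp: set_plus_def)
  finally show ?thesis .
qed

end

theorem propositionC:
  fixes scale :: "'f::field \<Rightarrow> 'a::ab_group_add \<Rightarrow> 'a"
    and mult :: "'a \<Rightarrow> 'a \<Rightarrow> 'a"
    and a b :: 'a
    and \<mu> \<delta> \<mu>' \<delta>' :: 'f
  assumes "nonassoc_algebra scale mult"
    and "CHAR('f) \<noteq> 2"
    and "nonassoc_algebra.jordan_axis scale mult a \<mu> \<delta>"
    and "nonassoc_algebra.jordan_axis scale mult b \<mu>' \<delta>'"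
    and "nonassoc_algebra.generated_by scale mult {a, b}"
  shows "(UNIV :: 'a set) =
    module.span scale {a} + module.span scale {b} + module.span scale {mult a b}"
  using nonassoc_algebra.generated_by_two_jordan_axes[OF assms(1,3,4,5)] .

end
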